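(* Let $f\in\mathcal{F}$ be given by $f(z)=z+\sum_{n=2}^{\infty}a_nz^n$. Then (i) $|a_2^2-a_3|\le 1$; (ii) $|a_2a_3-a_4|\le 2$. These inequalities are sharp, with equality for the Koebe function $k(z)=z/(1-z)^2$ and its rotations.
   Context: $\mathbb{D}=\{z\in\mathbb{C}:|z|<1\}$ is the unit disk. $\mathcal{A}$ is the class of analytic functions $f$ on $\mathbb{D}$ with $f(0)=0$ and $f'(0)=1$. The class $\mathcal{F}$ is $$\mathcal{F}=\{f\in\mathcal{A}:\ \mathrm{Re}\,\big((1-z)^2f'(z)\big)>0\ \text{for all } z\in\mathbb{D}\}.$$ The rotations of a function $f\in\mathcal{A}$ are the functions $e^{-i\theta}f(e^{i\theta}z)$, $\theta\in\mathbb{R}$; thus the rotations of $k$ are the functions $z/(1-xz)^2$ with $|x|=1$. *)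

theory Defs
  imports "HOL-Complex_Analysis.Complex_Analysis"
begin

text \<open>Functions on the unit disk are represented by total functions on the complex plane;
  the values outside the disk are irrelevant to all notions below.\<close>

abbreviation unit_disk :: "complex set" where
  "unit_disk \<equiv> ball 0 1"

definition class_A :: "(complex \<Rightarrow> complex) set" where
  "class_A = {f. f analytic_on unit_disk \<and> f 0 = 0 \<and> deriv f 0 = 1}"

definition class_F :: "(complex \<Rightarrow> complex) set" where
  "class_F = {f \<in> class_A. \<forall>z\<in>unit_disk. Re ((1 - z)\<^sup>2 * deriv f z) > 0}"

text \<open>The expansion of \<open>f\<close> as \<open>z\<close> plus the sum of \<open>a n * z ^ n\<close> over \<open>n \<ge> 2\<close>, valid on the
  whole disk; \<open>a 0\<close> and \<open>a 1\<close> are unconstrained.\<close>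

definition has_expansion :: "(complex \<Rightarrow> complex) \<Rightarrow> (nat \<Rightarrow> complex) \<Rightarrow> bool" where
  "has_expansion f a \<longleftrightarrow>
     (\<forall>z\<in>unit_disk. (\<lambda>n. a (n + 2) * z ^ (n + 2)) sums (f z - z))"

definition koebe :: "complex \<Rightarrow> complex" where
  "koebe z = z / (1 - z)\<^sup>2"

definition rotation :: "real \<Rightarrow> (complex \<Rightarrow> complex) \<Rightarrow> complex \<Rightarrow> complex" where
  "rotation \<theta> f z = cis (- \<theta>) * f (cis \<theta> * z)"

end

theory Submission
  imports Defs
begin

text \<open>
  For \<open>f\<close> in the class the function \<open>p z = (1 - z)\<^sup>2 * f' z\<close> has positive real part and \<open>p 0 = 1\<close>,
  so \<open>(p - 1) / (p + 1)\<close> maps the disk into itself and fixes \<open>0\<close>. By Schwarz's lemma it equals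
  \<open>z * g z\<close> with \<open>\<bar>g\<bar> \<le> 1\<close> (\<open>class_F_Schur_function\<close>). Writing \<open>g z = c0 + c1 * z + c2 * z\<^sup>2 + ...\<close>,
  the identity \<open>(1 - z)\<^sup>2 * f' z * (1 - z * g z) = 1 + z * g z\<close> expresses \<open>a 2\<close>, \<open>a 3\<close>, \<open>a 4\<close>
  as polynomials in the \<open>c\<close>'s (\<open>class_F_coeffs\<close>), and the two functionals become
  \<open>2/3 c0 + 1/3 c0\<^sup>2 - 2/3 c1\<close> and
  \<open>5/6 c0 + c0\<^sup>2 + 1/6 c0^3 - 1/3 c1 - 1/3 c0 c1 - 1/2 c2\<close>.

  In both, the coefficients of the pure powers of \<open>c0\<close> are positive and add up to the claimed
  bound. Passing to absolute values therefore costs nothing at the Koebe function, for which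
  \<open>g = 1\<close>, and only a bound for \<open>c1\<close> and \<open>c2\<close> that vanishes as \<open>\<bar>c0\<bar>\<close> tends to \<open>1\<close> has to be
  supplied. The bound \<open>\<bar>c n\<bar> \<le> 1 - \<bar>c0\<bar>\<^sup>2\<close> for bounded functions
  (\<open>norm_coeff_le_one_minus_square\<close>) suffices: what remains is to see that a polynomial in
  \<open>x = \<bar>c0\<bar>\<close> takes its maximum over \<open>[0, 1]\<close> at \<open>x = 1\<close>.
\<close>

section \<open>Coefficients of functions bounded by one\<close>

text \<open>Cauchy's inequality on the circle of radius \<open>r\<close> gives the bound \<open>r ^ (-n)\<close>; then \<open>r\<close> tends
  to \<open>1\<close>.\<close>

lemma norm_coeff_le_one:
  assumes "f holomorphic_on ball 0 1"
    and "\<And>z. norm z < 1 \<Longrightarrow> norm (f z) \<le> 1"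
    and "f has_fps_expansion F"
  shows "norm (fps_nth F n) \<le> 1"
proof -
  have bound: "norm (fps_nth F n) * r ^ n \<le> 1" if r: "0 < r" "r < 1" for r :: real
  proof -
    have "norm ((deriv ^^ n) f 0) \<le> fact n * 1 / r ^ n"
    proof (rule Cauchy_inequality)
      show "f holomorphic_on ball 0 r"
        using assms(1) by (rule holomorphic_on_subset) (use r in auto)
      have "f holomorphic_on cball 0 r"
        using assms(1) by (rule holomorphic_on_subset) (use r in auto)
      then show "continuous_on (cball 0 r) f"
        by (rule holomorphic_on_imp_continuous_on)
    qed (use assms(2) r in auto)
    then show ?thesis
      using r by (simp add: fps_nth_fps_expansion [OF assms(3)] norm_divide field_simps)
  qed
  have "((\<lambda>r. norm (fps_nth F n) * r ^ n) \<longlongrightarrow> norm (fps_nth F n) * 1 ^ n) (at_left (1::real))"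
    by (intro tendsto_intros)
  moreover have "\<forall>\<^sub>F r in at_left (1::real). norm (fps_nth F n) * r ^ n \<le> 1"
    using eventually_at_left_real[of 0 "1::real"] by (auto elim!: eventually_mono intro: bound)
  ultimately show ?thesis
    by (auto dest!: tendsto_upperbound)
qed

text \<open>Let \<open>b = g 0\<close>. The Moebius map that sends \<open>b\<close> to \<open>0\<close> turns \<open>g\<close> into a function \<open>\<phi>\<close> that is
  again bounded by one. When no term lies strictly between degrees \<open>0\<close> and \<open>n\<close>, comparing
  coefficients in \<open>\<phi> * (1 - cnj b * g) = g - b\<close> shows that the \<open>n\<close>-th coefficients differ exactly
  by the factor \<open>1 - \<bar>b\<bar>\<^sup>2\<close>, the value of \<open>1 - cnj b * g\<close> at \<open>0\<close>.\<close>

lemma norm_coeff_le_if_gap: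
  assumes holo: "g holomorphic_on ball 0 1"
    and le1: "\<And>z. norm z < 1 \<Longrightarrow> norm (g z) \<le> 1"
    and G: "g has_fps_expansion G"
    and "n > 0"
    and gap: "\<And>m. 0 < m \<Longrightarrow> m < n \<Longrightarrow> fps_nth G m = 0"
  shows "norm (fps_nth G n) \<le> 1 - (norm (fps_nth G 0))\<^sup>2"
  \<comment> \<open>The Moebius map needs arguments in the open disk. By the maximum principle only a constant
    \<open>g\<close> can leave it.\<close>
proof (cases "\<exists>\<xi>\<in>ball 0 1. norm (g \<xi>) = 1")
  case True
  then obtain \<xi> where \<xi>: "\<xi> \<in> ball 0 1" "norm (g \<xi>) = 1"
    by blast
  have "g constant_on ball 0 1"
    by (rule maximum_modulus_principle [OF holo _ _ _ order_refl \<xi>(1)])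
       (use le1 \<xi> in auto)
  then obtain c where c: "\<And>z. z \<in> ball 0 1 \<Longrightarrow> g z = c"
    by (auto simp: constant_on_def)
  have "\<forall>\<^sub>F z in nhds 0. z \<in> ball (0::complex) 1"
    by (intro eventually_nhds_in_open) auto
  then have "\<forall>\<^sub>F z in nhds 0. g z = c"
    by eventually_elim (rule c)
  then have "g has_fps_expansion fps_const c \<longleftrightarrow> (\<lambda>_. c) has_fps_expansion fps_const c"
    by (intro has_fps_expansion_cong) auto
  then have "G = fps_const c"
    using G fps_expansion_unique_complex by blast
  then show ?thesis
    using c [OF \<xi>(1)] \<xi>(2) \<open>n > 0\<close> by simp
next
  case False
  with le1 have lt1: "norm (g z) < 1" if "norm z < 1" for z
    using that by (metis less_eq_real_def mem_ball_0)
  define b where "b = g 0"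
  have G0: "fps_nth G 0 = b"
    using fps_nth_fps_expansion [OF G, of 0] by (simp add: b_def)
  have b: "norm b < 1"
    using lt1 by (simp add: b_def)
  define \<phi> where "\<phi> = (\<lambda>z. Moebius_function 0 b (g z))"
  have \<phi>_holo: "\<phi> holomorphic_on ball 0 1"
    unfolding \<phi>_def
    using holomorphic_on_compose_gen [OF holo Moebius_function_holomorphic [OF b, of 0],
        unfolded o_def]
    using lt1 by (simp add: image_subset_iff)
  have \<phi>_le1: "norm (\<phi> z) \<le> 1" if "norm z < 1" for z
    unfolding \<phi>_def using Moebius_function_norm_lt_1 [OF b lt1 [OF that]] by (simp add: less_imp_le)
  define \<Phi> where "\<Phi> = fps_expansion \<phi> 0"
  have \<Phi>: "\<phi> has_fps_expansion \<Phi>"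
    unfolding \<Phi>_def using \<phi>_holo by (intro has_fps_expansion_fps_expansion [of "ball 0 1"]) auto
  have den: "1 - cnj b * g z \<noteq> 0" if "norm z < 1" for z
  proof
    assume "1 - cnj b * g z = 0"
    then have "norm (cnj b * g z) = 1" by simp
    moreover have "norm (cnj b * g z) < 1"
      using norm_mult_less [of "cnj b" 1 "g z" 1] b lt1 [OF that] by simp
    ultimately show False by simp
  qed
  have "\<forall>\<^sub>F z in nhds 0. z \<in> ball (0::complex) 1"
    by (intro eventually_nhds_in_open) auto
  then have "\<forall>\<^sub>F z in nhds 0. \<phi> z * (1 - cnj b * g z) = g z - b"
    by eventually_elim (use den in \<open>simp add: \<phi>_def Moebius_function_simple\<close>)
  then have "(\<lambda>z. \<phi> z * (1 - cnj b * g z)) has_fps_expansion (G - fps_const b) \<longleftrightarrow>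
             (\<lambda>z. g z - b) has_fps_expansion (G - fps_const b)"
    by (intro has_fps_expansion_cong) auto
  moreover have "(\<lambda>z. g z - b) has_fps_expansion (G - fps_const b)"
    by (intro fps_expansion_intros G)
  moreover have "(\<lambda>z. \<phi> z * (1 - cnj b * g z)) has_fps_expansion \<Phi> * (1 - fps_const (cnj b) * G)"
    by (intro fps_expansion_intros G \<Phi>)
  ultimately have eq: "\<Phi> * (1 - fps_const (cnj b) * G) = G - fps_const b"
    using fps_expansion_unique_complex by blast
  have \<Phi>0: "fps_nth \<Phi> 0 = 0"
    using fps_nth_fps_expansion [OF \<Phi>, of 0]
    by (simp add: \<phi>_def b_def Moebius_function_eq_zero)
  have "fps_nth G n = fps_nth (\<Phi> * (1 - fps_const (cnj b) * G)) n"
    using \<open>n > 0\<close> by (simp add: eq)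
  also have "\<dots> = (\<Sum>i=0..n. fps_nth \<Phi> i * fps_nth (1 - fps_const (cnj b) * G) (n - i))"
    by (simp add: fps_mult_nth)
  also have "\<dots> = (\<Sum>i\<in>{n}. fps_nth \<Phi> i * fps_nth (1 - fps_const (cnj b) * G) (n - i))"
  proof (rule sum.mono_neutral_right)
    show "\<forall>i\<in>{0..n} - {n}. fps_nth \<Phi> i * fps_nth (1 - fps_const (cnj b) * G) (n - i) = 0"
    proof
      \<comment> \<open>For \<open>i = 0\<close> the first factor vanishes, for \<open>0 < i < n\<close> the gap makes the second one vanish.\<close>
      fix i assume "i \<in> {0..n} - {n}"
      then show "fps_nth \<Phi> i * fps_nth (1 - fps_const (cnj b) * G) (n - i) = 0"
        using \<Phi>0 gap [of "n - i"] by (cases "i = 0") auto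
    qed
  qed auto
  also have "\<dots> = fps_nth \<Phi> n * of_real (1 - (norm b)\<^sup>2)"
    by (simp add: G0 complex_norm_square [symmetric] mult.commute [of "cnj b"])
  finally have "norm (fps_nth G n) = norm (fps_nth \<Phi> n) * \<bar>1 - (norm b)\<^sup>2\<bar>"
    by (metis norm_mult norm_of_real)
  also have "\<dots> \<le> 1 * \<bar>1 - (norm b)\<^sup>2\<bar>"
    using norm_coeff_le_one [OF \<phi>_holo \<phi>_le1 \<Phi>] by (intro mult_right_mono) auto
  also have "\<bar>1 - (norm b)\<^sup>2\<bar> = 1 - (norm b)\<^sup>2"
    using b by (simp add: abs_square_le_1 less_imp_le)
  finally show ?thesis
    by (simp add: G0)
qed

text \<open>Averaging \<open>g (\<omega> ^ j * z)\<close> over the \<open>n\<close>-th roots of unity preserves the bound, keeps the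
  coefficients whose index is a multiple of \<open>n\<close> and removes all others. This produces the gap that
  the preceding lemma requires without changing the coefficients \<open>0\<close> and \<open>n\<close>.\<close>

lemma norm_coeff_le_one_minus_square:
  assumes holo: "g holomorphic_on ball 0 1"
    and le1: "\<And>z. norm z < 1 \<Longrightarrow> norm (g z) \<le> 1"
    and G: "g has_fps_expansion G"
    and n: "n > 0"
  shows "norm (fps_nth G n) \<le> 1 - (norm (fps_nth G 0))\<^sup>2"
proof -
  define \<omega> where "\<omega> = cis (2 * pi / real n)"
  have \<omega>_power: "\<omega> ^ m = cis (2 * pi * real m / real n)" for m
    by (simp add: \<omega>_def Complex.DeMoivre mult_ac)
  have \<omega>_n: "\<omega> ^ n = 1"
    using n by (simp add: \<omega>_power)
  have \<omega>_ne: "\<omega> ^ m \<noteq> 1" if "0 < m" "m < n" for m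
    using inj_onD [OF bij_betw_imp_inj_on [OF Complex.bij_betw_roots_unity [OF n]], of m 0] that n
    by (auto simp: \<omega>_power)
  have norm_\<omega>: "norm (\<omega> ^ j * z) = norm z" for j z
    by (simp add: norm_mult norm_power \<omega>_def)
  have maps: "z \<in> ball 0 1 \<Longrightarrow> \<omega> ^ j * z \<in> ball 0 1" for j z
    using norm_\<omega> by simp
  have rotated_holo: "(\<lambda>z. g (\<omega> ^ j * z)) holomorphic_on ball 0 1" for j
  proof -
    have "(g \<circ> (\<lambda>z. \<omega> ^ j * z)) holomorphic_on ball 0 1"
      using maps by (intro holomorphic_on_compose_gen [OF _ holo] holomorphic_intros) blast
    then show ?thesis by (simp add: o_def)
  qed
  define h where "h = (\<lambda>z. (\<Sum>j<n. g (\<omega> ^ j * z)) / of_nat n)"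
  have h_holo: "h holomorphic_on ball 0 1"
    unfolding h_def using n by (intro holomorphic_intros rotated_holo) auto
  have h_le1: "norm (h z) \<le> 1" if "norm z < 1" for z
  proof -
    have "norm (\<Sum>j<n. g (\<omega> ^ j * z)) \<le> (\<Sum>j<n. 1)"
      using le1 norm_\<omega> that by (intro sum_norm_le) metis
    then show ?thesis
      using n by (simp add: h_def norm_divide field_simps)
  qed
  define H where "H = fps_expansion h 0"
  have H: "h has_fps_expansion H"
    unfolding H_def using h_holo by (intro has_fps_expansion_fps_expansion [of "ball 0 1"]) auto
  have rotated: "(\<lambda>z. g (\<omega> ^ j * z)) has_fps_expansion Abs_fps (\<lambda>m. (\<omega> ^ j) ^ m * fps_nth G m)" for j
  proof -
    have "(deriv ^^ m) (\<lambda>z. g (\<omega> ^ j * z)) 0 = (\<omega> ^ j) ^ m * (deriv ^^ m) g 0" for m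
      using higher_deriv_compose_linear [OF holo, of "ball 0 1" 0 "\<omega> ^ j" m] maps by simp
    then have "fps_expansion (\<lambda>z. g (\<omega> ^ j * z)) 0 = Abs_fps (\<lambda>m. (\<omega> ^ j) ^ m * fps_nth G m)"
      by (simp add: fps_expansion_def fps_nth_fps_expansion [OF G])
    moreover have "(\<lambda>z. g (\<omega> ^ j * z)) has_fps_expansion fps_expansion (\<lambda>z. g (\<omega> ^ j * z)) 0"
      using rotated_holo by (intro has_fps_expansion_fps_expansion [of "ball 0 1"]) auto
    ultimately show ?thesis by simp
  qed
  have "(\<lambda>z. (\<Sum>j<n. g (\<omega> ^ j * z)) * inverse (of_nat n)) has_fps_expansion
    (\<Sum>j<n. Abs_fps (\<lambda>m. (\<omega> ^ j) ^ m * fps_nth G m)) * fps_const (inverse (of_nat n))"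
    by (intro fps_expansion_intros rotated)
  then have H_eq: "H = (\<Sum>j<n. Abs_fps (\<lambda>m. (\<omega> ^ j) ^ m * fps_nth G m)) * fps_const (inverse (of_nat n))"
    using H by (intro fps_expansion_unique_complex [of h]) (simp_all add: h_def field_simps)
  have H_nth: "fps_nth H m = fps_nth G m * (\<Sum>j<n. (\<omega> ^ m) ^ j) / of_nat n" for m
    by (simp add: H_eq fps_sum_nth sum_distrib_left power_mult [symmetric] mult_ac divide_inverse
        flip: sum_distrib_left)
  have "norm (fps_nth H n) \<le> 1 - (norm (fps_nth H 0))\<^sup>2"
  proof (rule norm_coeff_le_if_gap [OF h_holo h_le1 H n])
    fix m assume m: "0 < m" "m < n"
    have "(\<omega> ^ m) ^ n = 1"
      using \<omega>_n by (metis power_mult mult.commute power_one)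
    then show "fps_nth H m = 0"
      using \<omega>_ne [OF m] by (simp add: H_nth sum_gp_strict)
  qed
  then show ?thesis
    using n by (simp add: H_nth \<omega>_n)
qed

section \<open>The initial coefficients in the class \<open>\<F>\<close> and the two functionals\<close>

text \<open>The last identity is \<open>p = (1 + w) / (1 - w)\<close> for \<open>p z = (1 - z)\<^sup>2 * f' z\<close> and
  \<open>w z = z * g z\<close>. Without denominators it is a polynomial identity between power series.\<close>

lemma class_F_Schur_function:
  assumes "f \<in> class_F"
  obtains g where "g holomorphic_on ball 0 1" "\<And>z. norm z < 1 \<Longrightarrow> norm (g z) \<le> 1"
    "\<And>z. norm z < 1 \<Longrightarrow> (1 - z)\<^sup>2 * deriv f z * (1 - z * g z) = 1 + z * g z"
proof -
  define p where "p = (\<lambda>z. (1 - z)\<^sup>2 * deriv f z)"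
  have f_holo: "f holomorphic_on ball 0 1"
    using assms by (auto simp: class_F_def class_A_def analytic_on_open)
  have p_holo: "p holomorphic_on ball 0 1"
    unfolding p_def using f_holo by (intro holomorphic_intros) auto
  have p_Re: "Re (p z) > 0" if "norm z < 1" for z
    using assms that by (auto simp: class_F_def p_def)
  have p_ne: "p z + 1 \<noteq> 0" if "norm z < 1" for z
    using p_Re [OF that] by (auto simp: complex_eq_iff)
  have p0: "p 0 = 1"
    using assms by (simp add: class_F_def class_A_def p_def)
  define w where "w = (\<lambda>z. (p z - 1) / (p z + 1))"
  have w_holo: "w holomorphic_on ball 0 1"
    unfolding w_def using p_holo p_ne by (intro holomorphic_intros) auto
  have w0: "w 0 = 0"
    by (simp add: w_def p0)
  have w_lt1: "norm (w z) < 1" if "norm z < 1" for z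
  proof -
    have "(norm (p z - 1))\<^sup>2 < (norm (p z + 1))\<^sup>2"
      using p_Re [OF that] by (simp only: cmod_power2) (simp add: power2_eq_square algebra_simps)
    then have "norm (p z - 1) < norm (p z + 1)"
      by (rule power_less_imp_less_base) simp
    then show ?thesis
      using p_ne [OF that] by (simp add: w_def norm_divide)
  qed
  obtain g where g: "g holomorphic_on ball 0 1" "\<And>z. norm z < 1 \<Longrightarrow> w z = z * g z"
    "deriv w 0 = g 0"
    using Schwarz3 [OF w_holo w0] by blast
  show ?thesis
  proof
    show "norm (g z) \<le> 1" if "norm z < 1" for z
    proof (cases "z = 0")
      case True
      then show ?thesis
        using Schwarz_Lemma(2) [OF w_holo w0 w_lt1 that] g(3) by simp
    next
      case False
      then show ?thesis
        using Schwarz_Lemma(1) [OF w_holo w0 w_lt1 that] g(2) [OF that] by (simp add: norm_mult)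
    qed
    show "(1 - z)\<^sup>2 * deriv f z * (1 - z * g z) = 1 + z * g z" if "norm z < 1" for z
    proof -
      have "p z * (1 - w z) = 1 + w z"
        using p_ne [OF that] by (simp add: w_def field_simps)
      then show ?thesis
        by (simp add: p_def g(2) [OF that])
    qed
  qed (rule g(1))
qed

lemma has_expansion_imp_has_fps_expansion:
  assumes "has_expansion f a"
  shows "f has_fps_expansion Abs_fps (\<lambda>n. if n = 0 then 0 else if n = 1 then 1 else a n)"
    (is "_ has_fps_expansion ?F")
proof (rule has_fps_expansionI)
  have "\<forall>\<^sub>F z in nhds 0. z \<in> ball (0::complex) 1"
    by (intro eventually_nhds_in_open) auto
  then show "\<forall>\<^sub>F z in nhds 0. (\<lambda>n. fps_nth ?F n * z ^ n) sums f z"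
  proof eventually_elim
    case (elim z)
    then have "(\<lambda>n. fps_nth ?F (n + 2) * z ^ (n + 2)) sums (f z - z)"
      using assms by (simp add: has_expansion_def)
    then have "(\<lambda>n. fps_nth ?F n * z ^ n) sums (f z - z + (\<Sum>i<2. fps_nth ?F i * z ^ i))"
      using sums_iff_shift [of "\<lambda>n. fps_nth ?F n * z ^ n" 2] by simp
    then show ?case
      by (simp add: numeral_2_eq_2)
  qed
qed

text \<open>Here \<open>c\<close> is the coefficient sequence of the function \<open>g\<close> from \<open>class_F_Schur_function\<close>.
  The groups \<open>c 0\<close>, \<open>c 1 + (c 0)\<^sup>2\<close> and \<open>c 2 + 2 * c 0 * c 1 + (c 0) ^ 3\<close> are half the coefficients
  of \<open>(1 - z)\<^sup>2 * f' z\<close> at \<open>z\<close>, \<open>z\<^sup>2\<close> and \<open>z\<^sup>3\<close>. The factor \<open>1 / (1 - z)\<^sup>2\<close> gives them their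
  integer weights, and integrating \<open>f'\<close> gives the denominators.\<close>

lemma class_F_coeffs:
  assumes "f \<in> class_F" and "has_expansion f a"
  obtains c :: "nat \<Rightarrow> complex" where
    "norm (c 0) \<le> 1"
    "\<And>n. n > 0 \<Longrightarrow> norm (c n) \<le> 1 - (norm (c 0))\<^sup>2"
    "a 2 = 1 + c 0"
    "a 3 = 1 + (4 * c 0 + 2 * c 1 + 2 * (c 0)\<^sup>2) / 3"
    "a 4 = 1 + (3 * c 0 + 2 * (c 1 + (c 0)\<^sup>2) + c 2 + 2 * c 0 * c 1 + (c 0) ^ 3) / 2"
proof -
  obtain g where g: "g holomorphic_on ball 0 1" "\<And>z. norm z < 1 \<Longrightarrow> norm (g z) \<le> 1"
    "\<And>z. norm z < 1 \<Longrightarrow> (1 - z)\<^sup>2 * deriv f z * (1 - z * g z) = 1 + z * g z"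
    using class_F_Schur_function [OF assms(1)] by blast
  define G where "G = fps_expansion g 0"
  have G: "g has_fps_expansion G"
    unfolding G_def using g(1) by (intro has_fps_expansion_fps_expansion [of "ball 0 1"]) auto
  define F where "F = Abs_fps (\<lambda>n. if n = 0 then 0 else if n = 1 then 1 else a n)"
  have F: "f has_fps_expansion F"
    unfolding F_def by (rule has_expansion_imp_has_fps_expansion [OF assms(2)])
  have "\<forall>\<^sub>F z in nhds 0. z \<in> ball (0::complex) 1"
    by (intro eventually_nhds_in_open) auto
  then have "\<forall>\<^sub>F z in nhds 0. (1 - z)\<^sup>2 * deriv f z * (1 - z * g z) = 1 + z * g z"
    by eventually_elim (simp add: g(3))
  then have "(\<lambda>z. (1 - z)\<^sup>2 * deriv f z * (1 - z * g z)) has_fps_expansion 1 + fps_X * G \<longleftrightarrow>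
             (\<lambda>z. 1 + z * g z) has_fps_expansion 1 + fps_X * G"
    by (intro has_fps_expansion_cong) auto
  moreover have "(\<lambda>z. 1 + z * g z) has_fps_expansion 1 + fps_X * G"
    by (intro fps_expansion_intros G)
  moreover have "(\<lambda>z. (1 - z)\<^sup>2 * deriv f z * (1 - z * g z)) has_fps_expansion
      (1 - fps_X)\<^sup>2 * fps_deriv F * (1 - fps_X * G)"
    by (intro fps_expansion_intros G F)
  ultimately have eq: "(1 - fps_X)\<^sup>2 * fps_deriv F * (1 - fps_X * G) = 1 + fps_X * G"
    using fps_expansion_unique_complex by blast
  \<comment> \<open>Multiplying out by hand, so that a factor \<open>fps_X ^ k\<close> only shifts coefficients.\<close>
  define P where "P = fps_deriv F - fps_X * (fps_deriv F * G)"
  have "P - (fps_X * P + fps_X * P) + fps_X ^ 2 * P = 1 + fps_X * G"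
    using eq by (simp add: P_def power2_eq_square algebra_simps)
  then have nth: "fps_nth (P - (fps_X * P + fps_X * P) + fps_X ^ 2 * P) n = fps_nth (1 + fps_X * G) n"
    for n by simp
  have P: "fps_nth P 0 = 1" "fps_nth P 1 = 2 * a 2 - fps_nth G 0"
    "fps_nth P 2 = 3 * a 3 - (fps_nth G 1 + 2 * a 2 * fps_nth G 0)"
    "fps_nth P 3 = 4 * a 4 - (fps_nth G 2 + 2 * a 2 * fps_nth G 1 + 3 * a 3 * fps_nth G 0)"
    by (simp_all add: P_def F_def fps_mult_nth eval_nat_numeral sum.atLeast0_atMost_Suc)
  have rec: "fps_nth P 1 - (fps_nth P 0 + fps_nth P 0) = fps_nth G 0"
    "fps_nth P 2 - (fps_nth P 1 + fps_nth P 1) + fps_nth P 0 = fps_nth G 1"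
    "fps_nth P 3 - (fps_nth P 2 + fps_nth P 2) + fps_nth P 1 = fps_nth G 2"
    using nth [of 1] nth [of 2] nth [of 3] by (simp_all add: fps_X_power_mult_nth)
  have "2 * a 2 = 2 * (1 + fps_nth G 0)"
    using rec(1) P by (simp add: algebra_simps)
  then have a2: "a 2 = 1 + fps_nth G 0"
    unfolding mult_cancel_left by simp
  have a3: "3 * a 3 = 3 + 4 * fps_nth G 0 + 2 * fps_nth G 1 + 2 * (fps_nth G 0)\<^sup>2"
    using rec(2) unfolding P a2 by (simp add: power2_eq_square algebra_simps)
  have a4: "4 * a 4 = 4 + 6 * fps_nth G 0 + 4 * (fps_nth G 1 + (fps_nth G 0)\<^sup>2)
      + 2 * (fps_nth G 2 + 2 * fps_nth G 0 * fps_nth G 1 + fps_nth G 0 ^ 3)"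
    using rec(3) unfolding P a2 a3 by (simp add: power2_eq_square power3_eq_cube algebra_simps)
  show ?thesis
  proof
    show "norm (fps_nth G 0) \<le> 1"
      by (rule norm_coeff_le_one [OF g(1,2) G])
    show "norm (fps_nth G n) \<le> 1 - (norm (fps_nth G 0))\<^sup>2" if "n > 0" for n
      by (rule norm_coeff_le_one_minus_square [OF g(1,2) G that])
    show "a 3 = 1 + (4 * fps_nth G 0 + 2 * fps_nth G 1 + 2 * (fps_nth G 0)\<^sup>2) / 3"
      using a3 by (simp add: field_simps)
    show "a 4 = 1 + (3 * fps_nth G 0 + 2 * (fps_nth G 1 + (fps_nth G 0)\<^sup>2) + fps_nth G 2
        + 2 * fps_nth G 0 * fps_nth G 1 + fps_nth G 0 ^ 3) / 2"
    proof -
      have "a 4 = (4 * a 4) / 4"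
        by simp
      also have "\<dots> = 1 + (3 * fps_nth G 0 + 2 * (fps_nth G 1 + (fps_nth G 0)\<^sup>2) + fps_nth G 2
          + 2 * fps_nth G 0 * fps_nth G 1 + fps_nth G 0 ^ 3) / 2"
        unfolding a4 by (simp add: field_simps)
      finally show ?thesis .
    qed
  qed (rule a2)
qed

text \<open>With \<open>x = \<bar>c0\<bar>\<close>, the triangle inequality leaves the polynomials \<open>1 - (1 - x)\<^sup>2 / 3\<close> and
  \<open>2 - (1 - x) * (7 - x\<^sup>2) / 6\<close>.\<close>

lemma bounds_from_Schur_coeffs:
  fixes c0 c1 c2 :: complex
  assumes "norm c0 \<le> 1" "norm c1 \<le> 1 - (norm c0)\<^sup>2" "norm c2 \<le> 1 - (norm c0)\<^sup>2"
  shows "norm (2 / 3 * c0 + 1 / 3 * c0\<^sup>2 - 2 / 3 * c1) \<le> 1"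
    and "norm (5 / 6 * c0 + c0\<^sup>2 + 1 / 6 * c0 ^ 3 - 1 / 3 * c1 - 1 / 3 * (c0 * c1) - 1 / 2 * c2) \<le> 2"
proof -
  define x where "x = norm c0"
  have x: "0 \<le> x" "x \<le> 1"
    using assms(1) by (auto simp: x_def)
  have c1: "norm c1 \<le> 1 - x\<^sup>2" and c2: "norm c2 \<le> 1 - x\<^sup>2"
    using assms by (auto simp: x_def)
  have "norm (2 / 3 * c0 + 1 / 3 * c0\<^sup>2 - 2 / 3 * c1) \<le> 2 / 3 * x + 1 / 3 * x\<^sup>2 + 2 / 3 * norm c1"
    unfolding x_def by (rule order_trans [OF norm_triangle_ineq4] add_mono norm_triangle_le)+
      (simp_all add: norm_mult norm_power)
  also have "\<dots> \<le> 2 / 3 * x + 1 / 3 * x\<^sup>2 + 2 / 3 * (1 - x\<^sup>2)"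
    using c1 by simp
  also have "\<dots> = 1 - (1 - x)\<^sup>2 / 3"
    by (simp add: power2_eq_square field_simps)
  also have "\<dots> \<le> 1"
    by simp
  finally show "norm (2 / 3 * c0 + 1 / 3 * c0\<^sup>2 - 2 / 3 * c1) \<le> 1" .

  have "norm (5 / 6 * c0 + c0\<^sup>2 + 1 / 6 * c0 ^ 3 - 1 / 3 * c1 - 1 / 3 * (c0 * c1) - 1 / 2 * c2)
      \<le> 5 / 6 * x + x\<^sup>2 + 1 / 6 * x ^ 3 + 1 / 3 * norm c1 + 1 / 3 * (x * norm c1) + 1 / 2 * norm c2"
    unfolding x_def by (rule order_trans [OF norm_triangle_ineq4] add_mono norm_triangle_le)+
      (simp_all add: norm_mult norm_power)
  also have "\<dots> \<le> 5 / 6 * x + x\<^sup>2 + 1 / 6 * x ^ 3 + 1 / 3 * (1 - x\<^sup>2) + 1 / 3 * (x * (1 - x\<^sup>2))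
      + 1 / 2 * (1 - x\<^sup>2)"
    using c1 c2 x by (intro add_mono mult_left_mono) auto
  also have "\<dots> = 2 - (1 - x) * (7 - x\<^sup>2) / 6"
    by (simp add: power2_eq_square power3_eq_cube field_simps)
  also have "\<dots> \<le> 2"
  proof -
    have "x\<^sup>2 \<le> 1" using x by (simp add: power_le_one)
    then have "0 \<le> (1 - x) * (7 - x\<^sup>2)" using x by (intro mult_nonneg_nonneg) auto
    then show ?thesis by simp
  qed
  finally show "norm (5 / 6 * c0 + c0\<^sup>2 + 1 / 6 * c0 ^ 3 - 1 / 3 * c1 - 1 / 3 * (c0 * c1)
      - 1 / 2 * c2) \<le> 2" .
qed

section \<open>The Koebe function\<close>

lemma koebe_in_class_F: "koebe \<in> class_F"
proof -
  have der: "(koebe has_field_derivative (1 + z) / (1 - z) ^ 3) (at z)" if "norm z < 1" for z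
  proof -
    have "1 - z \<noteq> 0"
      using that by auto
    then show ?thesis
      unfolding koebe_def
      by (auto intro!: derivative_eq_intros simp: divide_simps power2_eq_square power3_eq_cube)
         (simp add: algebra_simps)
  qed
  have deriv: "deriv koebe z = (1 + z) / (1 - z) ^ 3" if "norm z < 1" for z
    using der [OF that] by (rule DERIV_imp_deriv)
  have "koebe holomorphic_on ball 0 1"
    using der by (intro holomorphic_onI) (auto simp: field_differentiable_def
        intro: has_field_derivative_at_within)
  moreover have "Re ((1 - z)\<^sup>2 * deriv koebe z) > 0" if "norm z < 1" for z
  proof -
    have nz: "1 - z \<noteq> 0"
      using that by auto
    have "(1 - z)\<^sup>2 * deriv koebe z = (1 + z) / (1 - z)"
      using nz by (simp add: deriv [OF that] power2_eq_square power3_eq_cube)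
    moreover have "Re ((1 + z) / (1 - z)) = (1 - (norm z)\<^sup>2) / (norm (1 - z))\<^sup>2"
      by (simp add: Re_divide cmod_power2) (simp add: power2_eq_square algebra_simps)
    moreover have "(norm z)\<^sup>2 < 1"
      using that by (simp add: abs_square_less_1)
    ultimately show ?thesis
      using nz by simp
  qed
  ultimately show ?thesis
    by (auto simp: class_F_def class_A_def analytic_on_open koebe_def deriv [of 0, simplified])
qed

text \<open>Put \<open>x = cis \<theta> * z\<close>. Then the rotation equals \<open>z / (1 - x)\<^sup>2\<close>, which is \<open>z\<close> times the
  differentiated geometric series.\<close>

lemma has_expansion_rotation_koebe:
  "has_expansion (rotation \<theta> koebe) (\<lambda>n. of_nat n * cis \<theta> ^ (n - 1))"
  unfolding has_expansion_def
proof
  fix z :: complex assume z: "z \<in> ball 0 1"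
  define x where "x = cis \<theta> * z"
  have "norm x < 1"
    using z by (simp add: x_def norm_mult)
  then have "(\<lambda>n. z * (of_nat (Suc n) * x ^ n)) sums (z * (1 / (1 - x)\<^sup>2))"
    by (intro sums_mult geometric_deriv_sums)
  then have "(\<lambda>n. z * (of_nat (Suc (Suc n)) * x ^ Suc n)) sums (z * (1 / (1 - x)\<^sup>2) - z)"
    using sums_iff_shift [of "\<lambda>n. z * (of_nat (Suc n) * x ^ n)" 1] by simp
  moreover have "z * (1 / (1 - x)\<^sup>2) = rotation \<theta> koebe z"
    by (simp add: rotation_def koebe_def x_def cis_mult mult.assoc [symmetric])
  moreover have "(\<lambda>n. z * (of_nat (Suc (Suc n)) * x ^ Suc n))
      = (\<lambda>n. of_nat (n + 2) * cis \<theta> ^ (n + 2 - 1) * z ^ (n + 2))"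
    by (simp add: x_def power_mult_distrib mult_ac)
  ultimately show "(\<lambda>n. of_nat (n + 2) * cis \<theta> ^ (n + 2 - 1) * z ^ (n + 2)) sums
      (rotation \<theta> koebe z - z)"
    by (simp only:)
qed

text \<open>For the coefficients \<open>n * x ^ (n - 1)\<close> with \<open>\<bar>x\<bar> = 1\<close> the functionals are \<open>x\<^sup>2\<close> and
  \<open>2 * x ^ 3\<close>.\<close>

lemma rotation_koebe_extremal:
  "\<exists>a. has_expansion (rotation \<theta> koebe) a \<and>
       cmod ((a 2)\<^sup>2 - a 3) = 1 \<and> cmod (a 2 * a 3 - a 4) = 2"
proof -
  define x where "x = cis \<theta>"
  have "norm x = 1"
    by (simp add: x_def)
  moreover have "(2 * x)\<^sup>2 - 3 * x\<^sup>2 = x\<^sup>2" "2 * x * (3 * x\<^sup>2) - 4 * x ^ 3 = 2 * x ^ 3"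
    by (simp_all add: power2_eq_square power3_eq_cube)
  ultimately show ?thesis
    by (intro exI [of _ "\<lambda>n. of_nat n * cis \<theta> ^ (n - 1)"] conjI has_expansion_rotation_koebe)
       (simp_all add: norm_mult norm_power flip: x_def)
qed

theorem theorem5p1:
  shows "(\<forall>f\<in>class_F. \<forall>a. has_expansion f a \<longrightarrow>
            cmod ((a 2)\<^sup>2 - a 3) \<le> 1 \<and> cmod (a 2 * a 3 - a 4) \<le> 2)
    \<and> koebe \<in> class_F
    \<and> (\<exists>a. has_expansion koebe a \<and>
            cmod ((a 2)\<^sup>2 - a 3) = 1 \<and> cmod (a 2 * a 3 - a 4) = 2)
    \<and> (\<forall>\<theta>. \<exists>a. has_expansion (rotation \<theta> koebe) a \<and>
            cmod ((a 2)\<^sup>2 - a 3) = 1 \<and> cmod (a 2 * a 3 - a 4) = 2)"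
proof (intro conjI ballI allI impI)
  fix f a assume "f \<in> class_F" "has_expansion f a"
  then obtain c :: "nat \<Rightarrow> complex" where c: "norm (c 0) \<le> 1"
    "\<And>n. n > 0 \<Longrightarrow> norm (c n) \<le> 1 - (norm (c 0))\<^sup>2"
    and a: "a 2 = 1 + c 0" "a 3 = 1 + (4 * c 0 + 2 * c 1 + 2 * (c 0)\<^sup>2) / 3"
      "a 4 = 1 + (3 * c 0 + 2 * (c 1 + (c 0)\<^sup>2) + c 2 + 2 * c 0 * c 1 + (c 0) ^ 3) / 2"
    using class_F_coeffs by blast
  note bounds = bounds_from_Schur_coeffs [OF c(1) c(2) [of 1] c(2) [of 2], simplified]
  have "(a 2)\<^sup>2 - a 3 = 2 / 3 * c 0 + 1 / 3 * (c 0)\<^sup>2 - 2 / 3 * c 1"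
    by (simp add: a power2_eq_square field_simps)
  then show "cmod ((a 2)\<^sup>2 - a 3) \<le> 1"
    using bounds(1) by simp
  have "a 2 * a 3 - a 4 = 5 / 6 * c 0 + (c 0)\<^sup>2 + 1 / 6 * (c 0) ^ 3 - 1 / 3 * c 1
      - 1 / 3 * (c 0 * c 1) - 1 / 2 * c 2"
    by (simp add: a power2_eq_square power3_eq_cube field_simps)
  then show "cmod (a 2 * a 3 - a 4) \<le> 2"
    using bounds(2) by simp
next
  have "rotation 0 koebe = koebe"
    by (auto simp: rotation_def)
  then show "\<exists>a. has_expansion koebe a \<and>
      cmod ((a 2)\<^sup>2 - a 3) = 1 \<and> cmod (a 2 * a 3 - a 4) = 2"
    using rotation_koebe_extremal [of 0] by simp
qed (rule koebe_in_class_F rotation_koebe_extremal)+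

end
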